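(* There is an absolute constant $c>0$ such that for all integers $n\ge 2$, $q\ge 1$, $m\ge1$ and every antichain $A=\{\alpha_0,\ldots,\alpha_{n-1}\}\subset\{0,1\}^m$ of cardinality $n$, $$L(S_{q,A}) \ge q n\log_2 n - c\, q n .$$
   Context: $L(F)$ denotes the minimal number of gates in a circuit over the basis $\{\vee,\wedge\}$ (binary disjunction and conjunction gates, inputs being the variables) computing the (possibly partially defined) boolean operator $F$; a circuit computes a partially defined operator if its outputs agree with $F$ on every input where $F$ is defined. Let $X=(x_0,\ldots,x_{n-1})$ with $x_i=(x_{i,0},\ldots,x_{i,q-1})^T$ be a $q\times n$ matrix of boolean variables, and $Y=(y_0,\ldots,y_{m-1})$ a vector of boolean variables. For a sequence $v=(v_0,\ldots,v_{n-1})$, $v\gg k$ denotes its cyclic shift by $k$ positions to the right, i.e. the sequence whose entry at position $(j+k)\bmod n$ is $v_j$. The monotone cyclic shift operator $S_{q,A}(X,Y)=(s_0,\ldots,s_{n-1})$ is the partially defined operator defined only for $Y\in A$, with $S_{q,A}(X,\alpha_k)=X\gg k$ for $k=0,\ldots,n-1$ and all $X\in\{0,1\}^{q\times n}$. *)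

theory Defs
  imports Complex_Main "HOL-Library.Extended_Real"
begin

section \<open>Monotone circuits\<close>

text \<open>A circuit is a straight-line program: a list of gates together with a node for each output.
  An argument or output \<open>Gate j\<close> refers to the gate at position \<open>j\<close> of the list. Constants are not
  available as inputs.\<close>

datatype 'v node = Var 'v | Gate nat

datatype 'v gate = Disj "'v node" "'v node" | Conj "'v node" "'v node"

type_synonym ('v, 'o) circuit = "'v gate list \<times> ('o \<Rightarrow> 'v node)"

fun valid_node :: "'v set \<Rightarrow> nat \<Rightarrow> 'v node \<Rightarrow> bool" where
  "valid_node V i (Var v) \<longleftrightarrow> v \<in> V"
| "valid_node V i (Gate j) \<longleftrightarrow> j < i"

fun valid_gate :: "'v set \<Rightarrow> nat \<Rightarrow> 'v gate \<Rightarrow> bool" where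
  "valid_gate V i (Disj a b) \<longleftrightarrow> valid_node V i a \<and> valid_node V i b"
| "valid_gate V i (Conj a b) \<longleftrightarrow> valid_node V i a \<and> valid_node V i b"

fun valid_circuit :: "'v set \<Rightarrow> 'o set \<Rightarrow> ('v, 'o) circuit \<Rightarrow> bool" where
  "valid_circuit V Z (gs, out) \<longleftrightarrow>
     (\<forall>i < length gs. valid_gate V i (gs ! i)) \<and> (\<forall>z \<in> Z. valid_node V (length gs) (out z))"

fun node_val :: "('v \<Rightarrow> bool) \<Rightarrow> bool list \<Rightarrow> 'v node \<Rightarrow> bool" where
  "node_val \<sigma> vals (Var v) = \<sigma> v"
| "node_val \<sigma> vals (Gate j) = vals ! j"

fun gate_val :: "('v \<Rightarrow> bool) \<Rightarrow> bool list \<Rightarrow> 'v gate \<Rightarrow> bool" where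
  "gate_val \<sigma> vals (Disj a b) \<longleftrightarrow> node_val \<sigma> vals a \<or> node_val \<sigma> vals b"
| "gate_val \<sigma> vals (Conj a b) \<longleftrightarrow> node_val \<sigma> vals a \<and> node_val \<sigma> vals b"

definition gate_vals :: "('v \<Rightarrow> bool) \<Rightarrow> 'v gate list \<Rightarrow> bool list" where
  "gate_vals \<sigma> gs = foldl (\<lambda>vals g. vals @ [gate_val \<sigma> vals g]) [] gs"

fun circuit_val :: "('v, 'o) circuit \<Rightarrow> ('v \<Rightarrow> bool) \<Rightarrow> 'o \<Rightarrow> bool" where
  "circuit_val (gs, out) \<sigma> z = node_val \<sigma> (gate_vals \<sigma> gs) (out z)"

text \<open>A partially defined boolean operator with variables \<open>V\<close> and outputs indexed by \<open>Z\<close> is a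
  partial map on assignments; only the output components in \<open>Z\<close> are relevant.\<close>

type_synonym ('v, 'o) operator = "('v \<Rightarrow> bool) \<rightharpoonup> ('o \<Rightarrow> bool)"

definition computes :: "'v set \<Rightarrow> 'o set \<Rightarrow> ('v, 'o) circuit \<Rightarrow> ('v, 'o) operator \<Rightarrow> bool" where
  "computes V Z C F \<longleftrightarrow> valid_circuit V Z C \<and>
     (\<forall>\<sigma> r. F \<sigma> = Some r \<longrightarrow> (\<forall>z \<in> Z. circuit_val C \<sigma> z = r z))"

text \<open>The value is \<open>\<infinity>\<close> iff no monotone circuit computes \<open>F\<close>.\<close>

definition monotone_complexity :: "'v set \<Rightarrow> 'o set \<Rightarrow> ('v, 'o) operator \<Rightarrow> enat" where
  "monotone_complexity V Z F = (INF C \<in> {C. computes V Z C F}. enat (length (fst C)))"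


section \<open>The monotone cyclic shift operator\<close>

definition antichain :: "bool list set \<Rightarrow> bool" where
  "antichain A \<longleftrightarrow> (\<forall>a \<in> A. \<forall>b \<in> A. list_all2 (\<le>) a b \<longrightarrow> a = b)"

text \<open>The sequence \<open>v 0, \<dots>, v (n - 1)\<close> shifted cyclically by \<open>k\<close> positions to the right.\<close>

definition cyclic_shift :: "nat \<Rightarrow> (nat \<Rightarrow> 'a) \<Rightarrow> nat \<Rightarrow> (nat \<Rightarrow> 'a)" where
  "cyclic_shift n v k = (\<lambda>p. v ((p + (n - k mod n)) mod n))"

lemma cyclic_shift_nth:
  assumes "j < n"
  shows "cyclic_shift n v k ((j + k) mod n) = v j"
proof -
  have "((j + k) mod n + (n - k mod n)) mod n = (j + k mod n + (n - k mod n)) mod n"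
    by (metis mod_add_left_eq mod_add_right_eq)
  also have "j + k mod n + (n - k mod n) = j + n"
    using assms by (simp add: less_imp_le)
  finally show ?thesis
    using assms by (simp add: cyclic_shift_def)
qed

text \<open>\<open>XVar j i\<close> is the entry \<open>x\<^sub>j\<^sub>,\<^sub>i\<close>: row \<open>i < q\<close> of the column \<open>x\<^sub>j\<close>, \<open>j < n\<close>. Outputs are indexed by
  pairs \<open>(j, i)\<close> in the same order.\<close>

datatype shift_var = XVar nat nat | YVar nat

definition shift_vars :: "nat \<Rightarrow> nat \<Rightarrow> nat \<Rightarrow> shift_var set" where
  "shift_vars q n m = {XVar j i | j i. j < n \<and> i < q} \<union> {YVar l | l. l < m}"

definition shift_outputs :: "nat \<Rightarrow> nat \<Rightarrow> (nat \<times> nat) set" where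
  "shift_outputs q n = {..<n} \<times> {..<q}"

definition y_part :: "nat \<Rightarrow> (shift_var \<Rightarrow> bool) \<Rightarrow> bool list" where
  "y_part m \<sigma> = map (\<lambda>l. \<sigma> (YVar l)) [0..<m]"

definition x_part :: "(shift_var \<Rightarrow> bool) \<Rightarrow> nat \<Rightarrow> (nat \<Rightarrow> bool)" where
  "x_part \<sigma> = (\<lambda>j i. \<sigma> (XVar j i))"

text \<open>The \<open>k\<close> below is unique whenever \<open>\<alpha> 0, \<dots>, \<alpha> (n - 1)\<close> are distinct.\<close>

definition shift_operator ::
  "nat \<Rightarrow> nat \<Rightarrow> (nat \<Rightarrow> bool list) \<Rightarrow> (shift_var, nat \<times> nat) operator" where
  "shift_operator n m \<alpha> = (\<lambda>\<sigma>.
     if y_part m \<sigma> \<in> \<alpha> ` {..<n}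
     then Some (\<lambda>(j, i). cyclic_shift n (x_part \<sigma>) (THE k. k < n \<and> y_part m \<sigma> = \<alpha> k) j i)
     else None)"

definition shift_complexity :: "nat \<Rightarrow> nat \<Rightarrow> nat \<Rightarrow> (nat \<Rightarrow> bool list) \<Rightarrow> enat" where
  "shift_complexity q n m \<alpha> =
     monotone_complexity (shift_vars q n m) (shift_outputs q n) (shift_operator n m \<alpha>)"

end

theory Submission
  imports Defs
begin

text \<open>Fix \<open>Y = \<alpha>\<^sub>k\<close>. If a gate computes a single variable \<open>x\<close> as a function of \<open>X\<close>, then by
  monotonicity so does one of its two arguments. Following these arguments back from an output yields
  a path to an input, and the \<open>q n\<close> paths belonging to the same \<open>k\<close> are disjoint, because their gates
  compute different variables. The \<open>n\<close> paths that leave a fixed output for the different \<open>k\<close>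
  end in different inputs, so Kraft's inequality bounds their total length from below by
  \<open>n log n\<close>. Summing over all outputs, and counting every gate at most once for every \<open>k\<close>,
  shows that the circuit has at least \<open>q n log n\<close> gates.\<close>

section \<open>Evaluation and monotonicity of circuits\<close>

lemma gate_vals_snoc:
  "gate_vals \<sigma> (gs @ [g]) = gate_vals \<sigma> gs @ [gate_val \<sigma> (gate_vals \<sigma> gs) g]"
  by (simp add: gate_vals_def)

lemma length_gate_vals [simp]: "length (gate_vals \<sigma> gs) = length gs"
  by (induction gs rule: rev_induct) (simp_all add: gate_vals_snoc, simp add: gate_vals_def)

lemma node_val_append:
  "valid_node V (length vals) a \<Longrightarrow> node_val \<sigma> (vals @ ws) a = node_val \<sigma> vals a"
  by (cases a) (auto simp: nth_append)

lemma gate_val_append: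
  "valid_gate V (length vals) g \<Longrightarrow> gate_val \<sigma> (vals @ ws) g = gate_val \<sigma> vals g"
  by (cases g) (auto simp: node_val_append)

lemma valid_node_mono: "valid_node V i a \<Longrightarrow> i \<le> j \<Longrightarrow> valid_node V j a"
  by (cases a) auto

lemma valid_gate_mono: "valid_gate V i g \<Longrightarrow> i \<le> j \<Longrightarrow> valid_gate V j g"
  by (cases g) (auto intro: valid_node_mono)

lemma gate_vals_nth:
  assumes "\<forall>i < length gs. valid_gate V i (gs ! i)" "i < length gs"
  shows "gate_vals \<sigma> gs ! i = gate_val \<sigma> (gate_vals \<sigma> gs) (gs ! i)"
  using assms
proof (induction gs arbitrary: i rule: rev_induct)
  case (snoc g gs)
  have valid: "valid_gate V j (gs ! j)" if "j < length gs" for j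
    using snoc.prems(1)[rule_format, of j] that by (simp add: nth_append)
  show ?case
  proof (cases "i < length gs")
    case True
    have "valid_gate V (length (gate_vals \<sigma> gs)) (gs ! i)"
      using valid_gate_mono[OF valid[OF True]] True by simp
    with True valid snoc.IH[of i] show ?thesis
      by (simp add: gate_vals_snoc nth_append gate_val_append)
  next
    case False
    with snoc.prems(2) have i: "i = length gs" by simp
    have "valid_gate V (length (gate_vals \<sigma> gs)) g"
      using snoc.prems(1)[rule_format, of "length gs"] by simp
    with i show ?thesis
      by (simp add: gate_vals_snoc nth_append gate_val_append)
  qed
qed simp

text \<open>No gate negates, so truth passes upwards gate by gate. The induction is on the index
  bound \<open>i\<close>, as the arguments of gate \<open>j\<close> lie below
  \<open>j\<close>.\<close>

lemma node_val_mono: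
  assumes "\<forall>i < length gs. valid_gate V i (gs ! i)" "valid_node V (length gs) a"
    and "\<sigma> \<le> \<sigma>'" "node_val \<sigma> (gate_vals \<sigma> gs) a"
  shows "node_val \<sigma>' (gate_vals \<sigma>' gs) a"
proof -
  have node: "node_val \<sigma>' (gate_vals \<sigma>' gs) b"
    if "valid_node V i b" "i \<le> length gs" "node_val \<sigma> (gate_vals \<sigma> gs) b" for i b
    using that
  proof (induction i arbitrary: b rule: less_induct)
    case (less i)
    show ?case
    proof (cases b)
      case (Var v)
      with less.prems \<open>\<sigma> \<le> \<sigma>'\<close> show ?thesis by (auto simp: le_fun_def)
    next
      case (Gate j)
      with less.prems have j: "j < i" "j < length gs" by auto
      have IH: "node_val \<sigma>' (gate_vals \<sigma>' gs) a"
        if "valid_node V j a" "node_val \<sigma> (gate_vals \<sigma> gs) a" for a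
        using less.IH[of j a] that j by simp
      have "valid_gate V j (gs ! j)" using assms(1) j by simp
      with less.prems(3) Gate j show ?thesis
        by (cases "gs ! j") (auto simp: gate_vals_nth[OF assms(1)] intro: IH)
    qed
  qed
  show ?thesis using node[OF assms(2)] assms(4) by simp
qed

section \<open>Nodes that compute a single variable\<close>

text \<open>The variables in \<open>U\<close> are free and \<open>\<tau>\<close> freezes all others.
  Later \<open>U\<close> holds the entries of X, and \<open>\<tau>\<close> encodes the choice Y =
  \<open>\<alpha> k\<close>.\<close>

definition projects ::
  "'v gate list \<Rightarrow> 'v set \<Rightarrow> ('v \<Rightarrow> bool) \<Rightarrow> 'v node \<Rightarrow> 'v \<Rightarrow> bool" where
  "projects gs U \<tau> a v \<longleftrightarrow>
     (\<forall>\<sigma>. (\<forall>w. w \<notin> U \<longrightarrow> \<sigma> w = \<tau> w) \<longrightarrow> node_val \<sigma> (gate_vals \<sigma> gs) a = \<sigma> v)"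

lemma projectsD:
  "projects gs U \<tau> a v \<Longrightarrow> (\<And>w. w \<notin> U \<Longrightarrow> \<sigma> w = \<tau> w) \<Longrightarrow>
     node_val \<sigma> (gate_vals \<sigma> gs) a = \<sigma> v"
  by (auto simp: projects_def)

lemma projects_unique:
  assumes "projects gs U \<tau> a v" "projects gs U \<tau> a w" "v \<in> U"
  shows "v = w"
proof (rule ccontr)
  assume "v \<noteq> w"
  \<comment> \<open>Changing \<open>v\<close> alone is allowed since \<open>v\<close> is free;
    \<open>w\<close> keeps its value and \<open>v\<close> gets the opposite one.\<close>
  define \<sigma> where "\<sigma> = \<tau>(v := \<not> \<tau> w)"
  have "\<sigma> u = \<tau> u" if "u \<notin> U" for u using that \<open>v \<in> U\<close> by (auto simp: \<sigma>_def)
  then have "\<sigma> v = \<sigma> w"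
    using projectsD[OF assms(1), of \<sigma>] projectsD[OF assms(2), of \<sigma>] by blast
  with \<open>v \<noteq> w\<close> show False by (simp add: \<sigma>_def)
qed

lemma projects_Var: "projects gs U \<tau> (Var w) w"
  by (simp add: projects_def)

text \<open>One extreme assignment decides which argument to follow. For a disjunction, false
  \<open>v\<close> forces both arguments to be false, so only the assignments with \<open>v\<close>
  true matter; a conjunction is dual.\<close>

lemma projects_argument:
  assumes valid: "\<forall>i < length gs. valid_gate V i (gs ! i)" and j: "j < length gs"
    and args: "gs ! j = Disj a b \<or> gs ! j = Conj a b"
    and proj: "projects gs U \<tau> (Gate j) v" and "v \<in> U"
  shows "projects gs U \<tau> a v \<or> projects gs U \<tau> b v"
proof -
  have "valid_gate V j (gs ! j)" using valid j by simp
  then have ab: "valid_node V (length gs) a" "valid_node V (length gs) b"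
    using args j by (auto intro: valid_node_mono)
  let ?val = "\<lambda>\<sigma> a. node_val \<sigma> (gate_vals \<sigma> gs) a"
  have mono: "?val \<sigma>' c" if "c = a \<or> c = b" "\<sigma> \<le> \<sigma>'" "?val \<sigma> c" for \<sigma> \<sigma>' c
    using node_val_mono[OF valid] ab that by blast
  have gate: "gate_val \<sigma> (gate_vals \<sigma> gs) (gs ! j) = \<sigma> v" if "\<And>w. w \<notin> U \<Longrightarrow> \<sigma> w = \<tau> w" for \<sigma>
    using projectsD[OF proj that] gate_vals_nth[OF valid j, of \<sigma>] by simp
  show ?thesis
    using args
  proof
    assume disj: "gs ! j = Disj a b"
    \<comment> \<open>The least admissible assignment with \<open>v\<close> true: an argument true
      here stays true, by monotonicity, whenever \<open>v\<close> is true.\<close>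
    define \<rho> where "\<rho> = (\<lambda>w. if w \<in> U then w = v else \<tau> w)"
    have "?val \<rho> a \<or> ?val \<rho> b"
      using gate[of \<rho>] disj \<open>v \<in> U\<close> by (simp add: \<rho>_def)
    then obtain c where c: "c = a \<or> c = b" "?val \<rho> c" by blast
    have "?val \<sigma> c = \<sigma> v" if \<sigma>: "\<forall>w. w \<notin> U \<longrightarrow> \<sigma> w = \<tau> w" for \<sigma>
    proof (cases "\<sigma> v")
      case True
      with \<sigma> have "\<rho> \<le> \<sigma>" by (auto simp: \<rho>_def le_fun_def)
      with mono c True show ?thesis by blast
    next
      case False
      with gate[of \<sigma>] \<sigma> disj c(1) show ?thesis by auto
    qed
    with c(1) show ?thesis by (auto simp: projects_def)
  next
    assume conj: "gs ! j = Conj a b"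
    \<comment> \<open>Dually, the greatest admissible assignment with \<open>v\<close>
      false.\<close>
    define \<rho> where "\<rho> = (\<lambda>w. if w \<in> U then w \<noteq> v else \<tau> w)"
    have "\<not> ?val \<rho> a \<or> \<not> ?val \<rho> b"
      using gate[of \<rho>] conj \<open>v \<in> U\<close> by (simp add: \<rho>_def)
    then obtain c where c: "c = a \<or> c = b" "\<not> ?val \<rho> c" by blast
    have "?val \<sigma> c = \<sigma> v" if \<sigma>: "\<forall>w. w \<notin> U \<longrightarrow> \<sigma> w = \<tau> w" for \<sigma>
    proof (cases "\<sigma> v")
      case False
      with \<sigma> have "\<sigma> \<le> \<rho>" by (auto simp: \<rho>_def le_fun_def)
      with mono c False show ?thesis by blast
    next
      case True
      with gate[of \<sigma>] \<sigma> conj c(1) show ?thesis by auto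
    qed
    with c(1) show ?thesis by (auto simp: projects_def)
  qed
qed

text \<open>Instead of the gates on a chosen path, all gates below \<open>i\<close> that compute the same variable are
  counted; this can only make the left-hand side smaller.\<close>

lemma projects_Kraft:
  fixes \<tau> :: "'k \<Rightarrow> 'v \<Rightarrow> bool" and v :: "'k \<Rightarrow> 'v"
  assumes valid: "\<forall>i < length gs. valid_gate V i (gs ! i)"
    and "finite K" "inj_on v K" "v ` K \<subseteq> U"
    and "valid_node V i a" "i \<le> length gs" "\<forall>k\<in>K. projects gs U (\<tau> k) a (v k)"
  shows "(\<Sum>k\<in>K. (1/2::real) ^ card {g. g < i \<and> projects gs U (\<tau> k) (Gate g) (v k)}) \<le> 1"
  using assms(2-)
proof (induction i arbitrary: a K rule: less_induct)
  case (less i)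
  let ?N = "\<lambda>i k. card {g. g < i \<and> projects gs U (\<tau> k) (Gate g) (v k)}"
  show ?case
  proof (cases a)
    case (Var w)
    \<comment> \<open>The path ends here: an input projects to one variable only, so injectivity of
      \<open>v\<close> leaves at most one index.\<close>
    have "v k = w" if "k \<in> K" for k
      using projects_unique[OF _ projects_Var, of gs U "\<tau> k" w "v k"] less.prems(3,6) Var that
      by auto
    then have "card K \<le> 1"
      using less.prems(1,2) by (metis One_nat_def card_le_Suc0_iff_eq inj_onD)
    have "(\<Sum>k\<in>K. (1/2::real) ^ ?N i k) \<le> (\<Sum>k\<in>K. 1)"
      by (intro sum_mono) (simp add: power_le_one)
    with \<open>card K \<le> 1\<close> show ?thesis by simp
  next
    case (Gate j)
    with less.prems have j: "j < i" "j < length gs" by auto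
    obtain b c where args: "gs ! j = Disj b c \<or> gs ! j = Conj b c" by (cases "gs ! j") auto
    have "valid_gate V j (gs ! j)" using valid j by simp
    with args have bc: "valid_node V j b" "valid_node V j c" by auto
    \<comment> \<open>\<open>B\<close> collects the indices whose path can continue through
      \<open>b\<close>; all others must continue through \<open>c\<close>.\<close>
    define B where "B = {k\<in>K. projects gs U (\<tau> k) b (v k)}"
    have B: "B \<subseteq> K" "finite B" "finite (K - B)"
      using less.prems(1) by (auto simp: B_def)
    have c: "projects gs U (\<tau> k) c (v k)" if "k \<in> K - B" for k
      using projects_argument[OF valid j(2) args, of U "\<tau> k" "v k"] that less.prems(3,6) Gate
      by (auto simp: B_def)
    \<comment> \<open>Gate \<open>j\<close> is counted below \<open>i\<close> but not below
      \<open>j\<close>. The factor 1/2 gained pays for splitting \<open>K\<close> into two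
      parts.\<close>
    have half: "(1/2::real) ^ ?N i k \<le> 1/2 * (1/2) ^ ?N j k" if "k \<in> K" for k
    proof -
      have "projects gs U (\<tau> k) (Gate j) (v k)" using less.prems(6) Gate that by auto
      then have "insert j {g. g < j \<and> projects gs U (\<tau> k) (Gate g) (v k)}
          \<subseteq> {g. g < i \<and> projects gs U (\<tau> k) (Gate g) (v k)}"
        using j(1) by auto
      from card_mono[OF _ this] have "Suc (?N j k) \<le> ?N i k" by simp
      from power_decreasing[OF this, of "1/2::real"] show ?thesis by simp
    qed
    have "(\<Sum>k\<in>K. (1/2::real) ^ ?N i k) \<le> (\<Sum>k\<in>K. 1/2 * (1/2) ^ ?N j k)"
      by (intro sum_mono half)
    also have "\<dots> = 1/2 * (\<Sum>k\<in>K - B. (1/2) ^ ?N j k) + 1/2 * (\<Sum>k\<in>B. (1/2) ^ ?N j k)"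
      using less.prems(1) B(1) by (simp only: sum.subset_diff[of B K] sum_distrib_left)
    also have "\<dots> \<le> 1/2 * 1 + 1/2 * 1"
    proof (intro add_mono mult_left_mono)
      show "(\<Sum>k\<in>K - B. (1/2::real) ^ ?N j k) \<le> 1"
        using less.prems(2,3) j bc(2) B c
        by (intro less.IH[of j "K - B" c]) (auto intro: inj_on_subset)
      show "(\<Sum>k\<in>B. (1/2::real) ^ ?N j k) \<le> 1"
        using less.prems(2,3) j bc(1) B
        by (intro less.IH[of j B b]) (auto simp: B_def intro: inj_on_subset)
    qed auto
    finally show ?thesis by simp
  qed
qed

text \<open>The bound \<open>ln x \<le> x - 1\<close> is applied at
  \<open>x = n * (1/2) ^ l k\<close>, which is 1 in the extremal case of all lengths equal to
  \<open>log 2 n\<close>. After summation the right-hand side is at most 0 by the Kraft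
  hypothesis.\<close>

lemma sum_ge_card_log_card_if_Kraft:
  fixes l :: "'k \<Rightarrow> nat"
  assumes "finite K" "(\<Sum>k\<in>K. (1/2::real) ^ l k) \<le> 1"
  shows "real (card K) * log 2 (card K) \<le> (\<Sum>k\<in>K. real (l k))"
proof (cases "K = {}")
  case False
  define n where "n = real (card K)"
  have n: "n > 0" using False assms(1) by (simp add: n_def card_gt_0_iff)
  have "ln n - real (l k) * ln 2 \<le> n * (1/2) ^ l k - 1" for k
  proof -
    have "ln (n * (1/2) ^ l k) \<le> n * (1/2) ^ l k - 1"
      using n by (intro ln_le_minus_one) simp
    also have "ln (n * (1/2) ^ l k) = ln n - real (l k) * ln 2"
      using n by (simp add: ln_mult ln_realpow ln_div)
    finally show ?thesis .
  qed
  then have "(\<Sum>k\<in>K. ln n - real (l k) * ln 2) \<le> (\<Sum>k\<in>K. n * (1/2) ^ l k - 1)"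
    by (intro sum_mono)
  then have "n * ln n - (\<Sum>k\<in>K. real (l k)) * ln 2 \<le> n * (\<Sum>k\<in>K. (1/2) ^ l k) - n"
    by (simp add: sum_subtractf sum_distrib_left sum_distrib_right n_def)
  also have "\<dots> \<le> 0"
    using n assms(2) mult_left_mono[of _ 1 n] by simp
  finally have "n * ln n / ln 2 \<le> (\<Sum>k\<in>K. real (l k))"
    by (simp add: field_simps)
  then show ?thesis by (simp add: log_def n_def)
qed simp

section \<open>Application to the cyclic shift\<close>

lemma inj_on_diff_mod: "inj_on (\<lambda>k::nat. (p + (n - k)) mod n) {..<n}"
proof (rule inj_onI)
  \<comment> \<open>Over the integers the column shown at position \<open>p\<close> is
    \<open>p - k\<close> modulo \<open>n\<close>, free of truncated subtraction.\<close>
  have residue: "int ((p + (n - k)) mod n) = (int p - int k) mod int n" if "k < n" for k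
  proof -
    have "int ((p + (n - k)) mod n) = (int p + (int n - int k)) mod int n"
      using that by (simp add: zmod_int of_nat_diff add_diff_eq)
    also have "int p + (int n - int k) = int p - int k + int n" by simp
    finally show ?thesis by simp
  qed
  fix k k' assume "k \<in> {..<n}" "k' \<in> {..<n}"
    and "(p + (n - k)) mod n = (p + (n - k')) mod n"
  then have "k < n" "k' < n" "(int p - int k) mod int n = (int p - int k') mod int n"
    using residue[of k] residue[of k'] by auto
  then have "int n dvd int k' - int k"
    by (simp add: mod_eq_dvd_iff)
  with \<open>k < n\<close> \<open>k' < n\<close> show "k = k'"
    by (metis dvd_imp_mod_0 mod_eq_dvd_iff mod_less of_nat_eq_iff zmod_int)
qed

lemma shift_operator_eq:
  assumes "inj_on \<alpha> {..<n}" "k < n" "y_part m \<sigma> = \<alpha> k"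
  shows "shift_operator n m \<alpha> \<sigma> =
    Some (\<lambda>(p, i). \<sigma> (XVar ((p + (n - k)) mod n) i))"
proof -
  have "(THE k. k < n \<and> y_part m \<sigma> = \<alpha> k) = k"
    using assms by (intro the_equality) (auto dest: inj_onD)
  with assms show ?thesis
    by (auto simp: shift_operator_def cyclic_shift_def x_part_def)
qed

lemma shift_circuit_size:
  assumes inj: "inj_on \<alpha> {..<n}" and len: "\<forall>k<n. length (\<alpha> k) = m" and "n > 0"
    and comp: "computes (shift_vars q n m) (shift_outputs q n) (gs, out) (shift_operator n m \<alpha>)"
  shows "real q * real n * log 2 (real n) \<le> real (length gs)"
proof -
  let ?V = "shift_vars q n m" and ?Z = "shift_outputs q n"
  have valid: "\<forall>i < length gs. valid_gate ?V i (gs ! i)"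
    and valid_out: "\<And>z. z \<in> ?Z \<Longrightarrow> valid_node ?V (length gs) (out z)"
    using comp by (auto simp: computes_def)
  define U where "U = {XVar j i | j i. True}"
  \<comment> \<open>The value \<open>False\<close> on X is a dummy: \<open>projects\<close> reads
    \<open>\<tau> k\<close> only outside \<open>U\<close>.\<close>
  define \<tau> where "\<tau> k v = (case v of YVar l \<Rightarrow> \<alpha> k ! l | XVar j i \<Rightarrow> False)" for k v
  \<comment> \<open>The entry of X that output \<open>z\<close> shows after a shift by
    \<open>k\<close>.\<close>
  define v where "v z k = XVar ((fst z + (n - k)) mod n) (snd z)" for z k
  define P where "P k z = {g. g < length gs \<and> projects gs U (\<tau> k) (Gate g) (v z k)}" for k z
  have vU: "v z k \<in> U" for z k by (simp add: v_def U_def)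
  have out: "projects gs U (\<tau> k) (out z) (v z k)" if "z \<in> ?Z" "k < n" for z k
    unfolding projects_def
  proof (intro allI impI)
    fix \<sigma> assume "\<forall>w. w \<notin> U \<longrightarrow> \<sigma> w = \<tau> k w"
    then have "\<sigma> (YVar l) = \<alpha> k ! l" for l by (auto simp: U_def \<tau>_def)
    then have "y_part m \<sigma> = \<alpha> k"
      using len \<open>k < n\<close> by (intro nth_equalityI) (auto simp: y_part_def)
    from shift_operator_eq[OF inj \<open>k < n\<close> this] comp \<open>z \<in> ?Z\<close>
    show "node_val \<sigma> (gate_vals \<sigma> gs) (out z) = \<sigma> (v z k)"
      by (fastforce simp: computes_def v_def split: prod.splits)
  qed
  have per_output: "real n * log 2 (real n) \<le> (\<Sum>k<n. real (card (P k z)))" if "z \<in> ?Z" for z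
  proof -
    have "inj_on (v z) {..<n}"
      using inj_on_diff_mod[of "fst z" n] unfolding inj_on_def v_def by blast
    then have "(\<Sum>k<n. (1/2::real) ^ card (P k z)) \<le> 1"
      unfolding P_def using out[OF that] valid_out[OF that]
      by (intro projects_Kraft[OF valid]) (auto intro: vU)
    from sum_ge_card_log_card_if_Kraft[OF _ this] show ?thesis by simp
  qed
  have per_shift: "(\<Sum>z\<in>?Z. card (P k z)) \<le> length gs" if "k < n" for k
  proof -
    have "P k z \<inter> P k z' = {}" if "z \<in> ?Z" "z' \<in> ?Z" "z \<noteq> z'" for z z'
    proof (rule ccontr)
      assume "P k z \<inter> P k z' \<noteq> {}"
      then have "v z k = v z' k"
        using projects_unique[OF _ _ vU] unfolding P_def by blast
      then have eq: "(fst z + (n - k)) mod n = (fst z' + (n - k)) mod n" "snd z = snd z'"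
        by (simp_all add: v_def)
      \<comment> \<open>Adding \<open>k\<close> undoes the shift, so for fixed \<open>k\<close>
        distinct outputs show distinct variables.\<close>
      have inverse: "((p + (n - k)) mod n + k) mod n = p" if "p < n" for p
        using that \<open>k < n\<close> by (simp add: mod_add_left_eq)
      have "fst z < n" "fst z' < n"
        using \<open>z \<in> ?Z\<close> \<open>z' \<in> ?Z\<close> by (auto simp: shift_outputs_def)
      then have "fst z = fst z'"
        using eq(1) by (metis inverse)
      with eq(2) show False using \<open>z \<noteq> z'\<close> by (simp add: prod_eq_iff)
    qed
    then have "(\<Sum>z\<in>?Z. card (P k z)) = card (\<Union>z\<in>?Z. P k z)"
      by (intro card_UN_disjoint[symmetric]) (auto simp: P_def shift_outputs_def)
    also have "\<dots> \<le> card {..<length gs}"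
      by (intro card_mono) (auto simp: P_def)
    finally show ?thesis by simp
  qed
  \<comment> \<open>Double counting of the triples of a shift, an output and a gate: there are
    \<open>q * n\<close> outputs, and the extra factor \<open>n\<close> cancels against the number
    of shifts.\<close>
  have "real n * (real q * real n * log 2 (real n)) = (\<Sum>z\<in>?Z. real n * log 2 (real n))"
    by (simp add: shift_outputs_def)
  also have "\<dots> \<le> (\<Sum>z\<in>?Z. \<Sum>k<n. real (card (P k z)))"
    by (intro sum_mono per_output)
  also have "\<dots> = (\<Sum>k<n. real (\<Sum>z\<in>?Z. card (P k z)))"
    by (subst sum.swap) simp
  also have "\<dots> \<le> (\<Sum>k<n. real (length gs))"
    using per_shift by (intro sum_mono) (simp only: of_nat_le_iff lessThan_iff)
  finally show ?thesis using \<open>n > 0\<close> by simp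
qed

theorem theorem3:
  "\<exists>c::real. c > 0 \<and>
     (\<forall>(n::nat) (q::nat) (m::nat) (\<alpha> :: nat \<Rightarrow> bool list).
        n \<ge> 2 \<longrightarrow> q \<ge> 1 \<longrightarrow> m \<ge> 1 \<longrightarrow>
        (\<forall>k<n. length (\<alpha> k) = m) \<longrightarrow>
        card (\<alpha> ` {..<n}) = n \<longrightarrow>
        antichain (\<alpha> ` {..<n}) \<longrightarrow>
        ereal_of_enat (shift_complexity q n m \<alpha>)
          \<ge> ereal (real q * real n * log 2 (real n) - c * real q * real n))"
\<comment> \<open>\<open>shift_circuit_size\<close> loses no lower-order term, so the witness only
  has to be positive.\<close>
proof (intro exI[of _ 1] conjI allI impI)
  fix n q m :: nat and \<alpha> :: "nat \<Rightarrow> bool list"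
  assume "n \<ge> 2" and len: "\<forall>k<n. length (\<alpha> k) = m" and "card (\<alpha> ` {..<n}) = n"
  then have "n > 0" "inj_on \<alpha> {..<n}" by (auto intro: eq_card_imp_inj_on)
  define r where "r = real q * real n * log 2 (real n)"
  \<comment> \<open>Complexity is an infimum in \<open>enat\<close>, so the real bound is rounded up
    before it is compared with each circuit size.\<close>
  have "enat (nat \<lceil>r\<rceil>) \<le> shift_complexity q n m \<alpha>"
    unfolding shift_complexity_def monotone_complexity_def
  proof (intro INF_greatest)
    fix C assume "C \<in> {C. computes (shift_vars q n m) (shift_outputs q n) C (shift_operator n m \<alpha>)}"
    then have "r \<le> real (length (fst C))"
      using shift_circuit_size[OF \<open>inj_on \<alpha> {..<n}\<close> len \<open>n > 0\<close>, of q "fst C" "snd C"]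
      by (simp add: r_def)
    then show "enat (nat \<lceil>r\<rceil>) \<le> enat (length (fst C))"
      by (simp add: ceiling_le_iff nat_le_iff)
  qed
  then have "ereal_of_enat (enat (nat \<lceil>r\<rceil>)) \<le> ereal_of_enat (shift_complexity q n m \<alpha>)"
    by (simp only: ereal_of_enat_le_iff)
  moreover have "r - 1 * real q * real n \<le> real (nat \<lceil>r\<rceil>)"
    using real_nat_ceiling_ge[of r] by (simp add: order.trans[of _ r])
  ultimately show "ereal (real q * real n * log 2 (real n) - 1 * real q * real n)
      \<le> ereal_of_enat (shift_complexity q n m \<alpha>)"
    unfolding r_def[symmetric] by (metis ereal_less_eq(3) ereal_of_enat_simps(1) order.trans)
qed simp

end
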